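(* Fix a period $t\in\mathcal{T}$, a day-ahead decision, and renewable outputs $w_{kt}$, $k\in\mathcal{J}$. Consider the energy sharing game and its energy sharing market equilibria as defined in the context, and the centralized problem $$\begin{aligned}\min_{d_t,q_t}\quad&\sum_{k\in\mathcal{K}}U_k(d_{kt})\\ \text{s.t.}\quad& q_{kt}=d_{kt}+d_{kt}^f\ \ (k\in\mathcal{I}),\qquad w_{kt}+q_{kt}=d_{kt}+d_{kt}^f\ \ (k\in\mathcal{J})\qquad:\ \eta_{kt},\\ &\underline{D}_{kt}\le d_{kt}\le\overline{D}_{kt}\ \ (k\in\mathcal{K}),\qquad (q_{kt})_{k\in\mathcal{K}}\in\mathcal{F}_c,\end{aligned}\tag{C}$$ where $\eta_{kt}$ denotes the dual variable of the power balance equality of customer $k$. Then an energy sharing market equilibrium exists if and only if problem (C) is feasible. Moreover, if $(d_t^*,b_t^*,q_t^*,\lambda_t^* )$ is an energy sharing market equilibrium, then $d_t^*$ is the unique optimal solution (in the variable $d_t$) of (C); there exists a dual optimal $\hat\eta_t=(\hat\eta_{kt})_{k\in\mathcal{K}}$ of (C) such that $\lambda_{kt}^*=\hat\eta_{kt}$ for all $k\in\mathcal{K}$; and $q_{kt}^*=d_{kt}^*+d_{kt}^f$ for $k\in\mathcal{I}$, $q_{kt}^*=d_{kt}^*+d_{kt}^f-w_{kt}$ for $k\in\mathcal{J}$, and $b_{kt}^*=q_{kt}^*+a\lambda_{kt}^*$ for $k\in\mathcal{K}$.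
   Context: **Customers.** $\mathcal{I}$ (consumers) and $\mathcal{J}$ (prosumers) are disjoint finite sets and $\mathcal{K}=\mathcal{I}\cup\mathcal{J}$. Each customer $k$ has a strictly convex disutility function $U_k:\mathbb{R}\to\mathbb{R}$, a fixed demand $d_{kt}^f$, and an elastic demand $d_{kt}\in[\underline{D}_{kt},\overline{D}_{kt}]$; prosumer $k\in\mathcal{J}$ has a given renewable output $w_{kt}$. The market sensitivity is a constant $a>0$. Here $q_{kt}$, $\lambda_{kt}$ and $b_{kt}$ are the sharing quantity, sharing price and bid of customer $k$, all real; $d_t=(d_{kt})_{k\in\mathcal{K}}$, and similarly for $q_t,\lambda_t,b_t$. **Customer problem.** Given $\lambda_{kt}$, customer $k$ solves $$\min_{d_{kt},b_{kt},q_{kt}}\ U_k(d_{kt})+\lambda_{kt}q_{kt}$$ subject to $q_{kt}=-a\lambda_{kt}+b_{kt}$; $q_{kt}=d_{kt}+d_{kt}^f$ if $k\in\mathcal{I}$, or $w_{kt}+q_{kt}=d_{kt}+d_{kt}^f$ if $k\in\mathcal{J}$; and $\underline{D}_{kt}\le d_{kt}\le\overline{D}_{kt}$. **Operator problem.** Given the bids $b_t$, the operator solves $$\min_{\lambda_t}\ \sum_{k\in\mathcal{K}}\lambda_{kt}^2\quad\text{s.t.}\quad(-a\lambda_{kt}+b_{kt})_{k\in\mathcal{K}}\in\mathcal{F}_c.$$ **Network set $\mathcal{F}_c$.** $\mathcal{B}$ is the finite set of nodes, $\mathcal{L}$ the set of (directed) lines $(n,b)$, $\mathcal{G}$ the set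 of gas-fired units, and $\mathcal{E}$ the set of storage units. Each unit and each customer is located at a node, and $C(b)$ denotes those connected to node $b$. $\mathcal{F}_c$ is the set of $(q_{kt})_{k\in\mathcal{K}}\in\mathbb{R}^{\mathcal{K}}$ for which there exist reals $\Delta P_{gt},p_{et}^c,p_{et}^d,P_{bt},Q_{bt},P_{nb,t},Q_{nb,t},v_{bt}$ such that - $-r_{gt}\le\Delta P_{gt}\le r_{gt}$ for $g\in\mathcal{G}$; - $P_{bt}=P_{bt}^0-\sum_{g\in C(b)}(P_{gt}+\Delta P_{gt})+\sum_{k\in C(b)}q_{kt}-\sum_{e\in C(b)}(p_{et}^d-p_{et}^c)$ for $b\in\mathcal{B}$; - $Q_{bt}=Q_{bt}^0-\sum_{g\in C(b)}Q_{gt}$ for $b\in\mathcal{B}$; - $P_{nb,t}-P_{bt}-\sum_{(b,m)\in\mathcal{L}}P_{bm,t}=0$ and $Q_{nb,t}-Q_{bt}-\sum_{(b,m)\in\mathcal{L}}Q_{bm,t}=0$ for $(n,b)\in\mathcal{L}$; - $-\overline{P}_{nb}\le P_{nb,t}\le\overline{P}_{nb}$ and $-\overline{Q}_{nb}\le Q_{nb,t}\le\overline{Q}_{nb}$ for $(n,b)\in\mathcal{L}$; - $v_{nt}-(r_{nb}P_{nb,t}+x_{nb}Q_{nb,t})=v_{bt}$ for $(n,b)\in\mathcal{L}$; - $\underline{v}_b\le v_{bt}\le\overline{v}_b$ for $b\in\mathcal{B}$, and $v_{1t}=V_0$; - $\underline{p}_{et}^{DA,c}\le p_{et}^c\le\overline{p}_{et}^{DA,c}$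 and $\underline{p}_{et}^{DA,d}\le p_{et}^d\le\overline{p}_{et}^{DA,d}$ for $e\in\mathcal{E}$. All other symbols ($r_{gt},P_{gt},Q_{gt}$, the storage power bounds with superscript $DA$, the loads $P_{bt}^0,Q_{bt}^0$, line parameters and limits, voltage limits, $V_0$) are given real constants (network parameters or fixed day-ahead decisions). Thus $\mathcal{F}_c$ is the projection of a polyhedron defined by finitely many linear constraints. **Energy sharing market equilibrium.** A profile $(d_t^*,b_t^*,q_t^*,\lambda_t^* )$ such that for every $k\in\mathcal{K}$, $(d_{kt}^*,b_{kt}^*,q_{kt}^* )$ is an optimal solution of customer $k$'s problem with price $\lambda_{kt}^*$, and $\lambda_t^*$ is an optimal solution of the operator's problem with bids $b_t^*$. **Dual sign convention.** Dual variables refer to the Lagrangian $$\sum_{k\in\mathcal{K}}U_k(d_{kt})+\sum_{k\in\mathcal{I}}\eta_{kt}(d_{kt}+d_{kt}^f-q_{kt})+\sum_{k\in\mathcal{J}}\eta_{kt}(d_{kt}+d_{kt}^f-w_{kt}-q_{kt})$$ with $d_{kt}\in[\underline{D}_{kt},\overline{D}_{kt}]$ and $q_t\in\mathcal{F}_c$ kept as set constraints. *)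

theory Defs
  imports "HOL-Analysis.Analysis"
begin

text \<open>
  All data refer to one fixed period, with the day-ahead decision given, so the period index is
  left out.  Customers, nodes, gas-fired units and storage units form finite subsets of
  arbitrary types.  A vector indexed by such a set is a total function on the type; only its
  values on the set matter.
\<close>

record ('b, 'g, 'e) network =
  nodes :: "'b set"
  root :: 'b                              \<comment> \<open>node 1, whose voltage variable is fixed\<close>
  lines :: "('b \<times> 'b) set"
  gas_units :: "'g set"
  storages :: "'e set"
  gas_node :: "'g \<Rightarrow> 'b"
  storage_node :: "'e \<Rightarrow> 'b"
  gas_reserve :: "'g \<Rightarrow> real"            \<comment> \<open>\<open>r\<^sub>g\<close>\<close>
  gas_P :: "'g \<Rightarrow> real"
  gas_Q :: "'g \<Rightarrow> real"
  load_P :: "'b \<Rightarrow> real"                 \<comment> \<open>\<open>P\<^sub>b\<^sup>0\<close>\<close>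
  load_Q :: "'b \<Rightarrow> real"                 \<comment> \<open>\<open>Q\<^sub>b\<^sup>0\<close>\<close>
  line_P_max :: "'b \<times> 'b \<Rightarrow> real"
  line_Q_max :: "'b \<times> 'b \<Rightarrow> real"
  line_r :: "'b \<times> 'b \<Rightarrow> real"
  line_x :: "'b \<times> 'b \<Rightarrow> real"
  volt_min :: "'b \<Rightarrow> real"
  volt_max :: "'b \<Rightarrow> real"
  volt_root :: real                       \<comment> \<open>\<open>V\<^sub>0\<close>\<close>
  charge_min :: "'e \<Rightarrow> real"             \<comment> \<open>day-ahead storage power bounds (superscript \<open>DA\<close>)\<close>
  charge_max :: "'e \<Rightarrow> real"
  discharge_min :: "'e \<Rightarrow> real"
  discharge_max :: "'e \<Rightarrow> real"

record ('b, 'g, 'e, 'k) market = "('b, 'g, 'e) network" +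
  consumers :: "'k set"
  prosumers :: "'k set"
  customer_node :: "'k \<Rightarrow> 'b"
  disutility :: "'k \<Rightarrow> real \<Rightarrow> real"
  fixed_demand :: "'k \<Rightarrow> real"
  demand_min :: "'k \<Rightarrow> real"
  demand_max :: "'k \<Rightarrow> real"
  renewable :: "'k \<Rightarrow> real"              \<comment> \<open>\<open>w\<^sub>k\<close>; used for prosumers only\<close>
  sensitivity :: real                     \<comment> \<open>the constant \<open>a\<close>\<close>

definition customers :: "('b, 'g, 'e, 'k) market \<Rightarrow> 'k set" where
  "customers M = consumers M \<union> prosumers M"

definition strictly_convex :: "(real \<Rightarrow> real) \<Rightarrow> bool" where
  "strictly_convex f \<longleftrightarrow>
     (\<forall>x y u v. x \<noteq> y \<longrightarrow> 0 < u \<longrightarrow> 0 < v \<longrightarrow> u + v = 1 \<longrightarrow>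
        f (u * x + v * y) < u * f x + v * f y)"

locale energy_sharing_market =
  fixes M :: "('b, 'g, 'e, 'k) market"
  assumes finite_nodes: "finite (nodes M)"
    and root_node: "root M \<in> nodes M"
    and lines_nodes: "lines M \<subseteq> nodes M \<times> nodes M"
    and finite_gas_units: "finite (gas_units M)"
    and gas_node: "\<And>g. g \<in> gas_units M \<Longrightarrow> gas_node M g \<in> nodes M"
    and finite_storages: "finite (storages M)"
    and storage_node: "\<And>e. e \<in> storages M \<Longrightarrow> storage_node M e \<in> nodes M"
    and finite_consumers: "finite (consumers M)"
    and finite_prosumers: "finite (prosumers M)"
    and disjoint: "consumers M \<inter> prosumers M = {}"
    and customer_node: "\<And>k. k \<in> customers M \<Longrightarrow> customer_node M k \<in> nodes M"
    and disutility: "\<And>k. k \<in> customers M \<Longrightarrow> strictly_convex (disutility M k)"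
    and sensitivity: "sensitivity M > 0"

text \<open>
  The network set \<open>\<F>\<^sub>c\<close>.  The existential variables are: gas adjustments \<open>\<Delta>P\<close>, storage
  charging \<open>pc\<close> and discharging \<open>pd\<close>, nodal net loads \<open>P\<close>, \<open>Q\<close>, line flows \<open>PL\<close>, \<open>QL\<close>, and
  voltages \<open>v\<close>.
\<close>

definition network_set :: "('b, 'g, 'e, 'k) market \<Rightarrow> ('k \<Rightarrow> real) set" where
  "network_set M = {q. \<exists>\<Delta>P pc pd P Q PL QL v.
     (\<forall>g\<in>gas_units M. - gas_reserve M g \<le> \<Delta>P g \<and> \<Delta>P g \<le> gas_reserve M g) \<and>
     (\<forall>b\<in>nodes M. P b = load_P M b
         - (\<Sum>g\<in>{g \<in> gas_units M. gas_node M g = b}. gas_P M g + \<Delta>P g)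
         + (\<Sum>k\<in>{k \<in> customers M. customer_node M k = b}. q k)
         - (\<Sum>e\<in>{e \<in> storages M. storage_node M e = b}. pd e - pc e)) \<and>
     (\<forall>b\<in>nodes M. Q b = load_Q M b
         - (\<Sum>g\<in>{g \<in> gas_units M. gas_node M g = b}. gas_Q M g)) \<and>
     (\<forall>(n, b)\<in>lines M.
         PL (n, b) - P b - (\<Sum>m\<in>{m. (b, m) \<in> lines M}. PL (b, m)) = 0 \<and>
         QL (n, b) - Q b - (\<Sum>m\<in>{m. (b, m) \<in> lines M}. QL (b, m)) = 0) \<and>
     (\<forall>(n, b)\<in>lines M.
         - line_P_max M (n, b) \<le> PL (n, b) \<and> PL (n, b) \<le> line_P_max M (n, b) \<and>
         - line_Q_max M (n, b) \<le> QL (n, b) \<and> QL (n, b) \<le> line_Q_max M (n, b)) \<and>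
     (\<forall>(n, b)\<in>lines M.
         v n - (line_r M (n, b) * PL (n, b) + line_x M (n, b) * QL (n, b)) = v b) \<and>
     (\<forall>b\<in>nodes M. volt_min M b \<le> v b \<and> v b \<le> volt_max M b) \<and>
     v (root M) = volt_root M \<and>
     (\<forall>e\<in>storages M.
         charge_min M e \<le> pc e \<and> pc e \<le> charge_max M e \<and>
         discharge_min M e \<le> pd e \<and> pd e \<le> discharge_max M e)}"

definition power_balance :: "('b, 'g, 'e, 'k) market \<Rightarrow> 'k \<Rightarrow> real \<Rightarrow> real \<Rightarrow> bool" where
  "power_balance M k d q \<longleftrightarrow>
     (k \<in> consumers M \<longrightarrow> q = d + fixed_demand M k) \<and>
     (k \<in> prosumers M \<longrightarrow> renewable M k + q = d + fixed_demand M k)"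

definition customer_optimal ::
  "('b, 'g, 'e, 'k) market \<Rightarrow> 'k \<Rightarrow> real \<Rightarrow> real \<times> real \<times> real \<Rightarrow> bool" where
  "customer_optimal M k price =
     is_arg_min
       (\<lambda>(d, b, q). disutility M k d + price * q)
       (\<lambda>(d, b, q). q = - sensitivity M * price + b \<and> power_balance M k d q \<and>
          demand_min M k \<le> d \<and> d \<le> demand_max M k)"

definition operator_optimal ::
  "('b, 'g, 'e, 'k) market \<Rightarrow> ('k \<Rightarrow> real) \<Rightarrow> ('k \<Rightarrow> real) \<Rightarrow> bool" where
  "operator_optimal M b =
     is_arg_min
       (\<lambda>price. \<Sum>k\<in>customers M. (price k)\<^sup>2)
       (\<lambda>price. (\<lambda>k. - sensitivity M * price k + b k) \<in> network_set M)"

definition market_equilibrium ::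
  "('b, 'g, 'e, 'k) market \<Rightarrow>
     ('k \<Rightarrow> real) \<times> ('k \<Rightarrow> real) \<times> ('k \<Rightarrow> real) \<times> ('k \<Rightarrow> real) \<Rightarrow> bool" where
  "market_equilibrium M = (\<lambda>(d, b, q, price).
     (\<forall>k\<in>customers M. customer_optimal M k (price k) (d k, b k, q k)) \<and>
     operator_optimal M b price)"

definition total_disutility :: "('b, 'g, 'e, 'k) market \<Rightarrow> ('k \<Rightarrow> real) \<Rightarrow> real" where
  "total_disutility M d = (\<Sum>k\<in>customers M. disutility M k (d k))"

definition central_feasible ::
  "('b, 'g, 'e, 'k) market \<Rightarrow> ('k \<Rightarrow> real) \<times> ('k \<Rightarrow> real) \<Rightarrow> bool" where
  "central_feasible M = (\<lambda>(d, q).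
     (\<forall>k\<in>customers M. power_balance M k (d k) (q k)) \<and>
     (\<forall>k\<in>customers M. demand_min M k \<le> d k \<and> d k \<le> demand_max M k) \<and>
     q \<in> network_set M)"

definition central_optimal ::
  "('b, 'g, 'e, 'k) market \<Rightarrow> ('k \<Rightarrow> real) \<times> ('k \<Rightarrow> real) \<Rightarrow> bool" where
  "central_optimal M = is_arg_min (\<lambda>(d, q). total_disutility M d) (central_feasible M)"

definition lagrangian ::
  "('b, 'g, 'e, 'k) market \<Rightarrow> ('k \<Rightarrow> real) \<Rightarrow> ('k \<Rightarrow> real) \<Rightarrow> ('k \<Rightarrow> real) \<Rightarrow> real" where
  "lagrangian M \<eta> d q =
     total_disutility M d
     + (\<Sum>k\<in>consumers M. \<eta> k * (d k + fixed_demand M k - q k))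
     + (\<Sum>k\<in>prosumers M. \<eta> k * (d k + fixed_demand M k - renewable M k - q k))"

text \<open>
  Only the power balance is dualized.  As \<open>\<F>\<^sub>c\<close> may be unbounded, the dual function can take the
  value \<open>-\<infinity>\<close>; such multipliers are infeasible for the dual problem.
\<close>

definition dual_function :: "('b, 'g, 'e, 'k) market \<Rightarrow> ('k \<Rightarrow> real) \<Rightarrow> ereal" where
  "dual_function M \<eta> =
     (INF (d, q) \<in> {d. \<forall>k\<in>customers M. d k \<in> {demand_min M k..demand_max M k}} \<times> network_set M.
        ereal (lagrangian M \<eta> d q))"

definition dual_optimal :: "('b, 'g, 'e, 'k) market \<Rightarrow> ('k \<Rightarrow> real) \<Rightarrow> bool" where
  "dual_optimal M = is_arg_max (dual_function M) (\<lambda>\<eta>. dual_function M \<eta> > -\<infinity>)"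

end

theory Submission
  imports Defs
begin

text \<open>
  The operator's problem is a projection onto the convex set \<open>\<F>\<^sub>c\<close>, so \<open>\<lambda>\<close> solves it iff the
  quantities \<open>q\<close> maximize \<open>\<lambda> \<bullet> q\<close> over \<open>\<F>\<^sub>c\<close>.  Together with the customers' problems this
  says exactly that \<open>(d, q)\<close> and \<open>\<lambda>\<close> form a saddle point of the Lagrangian of (C).  A minimizer of
  (C) exists by compactness, since all network variables are bounded once the demands are.  That it
  has a multiplier needs no Slater point, because every constraint is affine: this convex Farkas
  lemma is proved by induction on the number of inequalities, for real-valued convex functions on
  affine sets.
\<close>

section \<open>Affine and convex sets and functions on vectors indexed by an arbitrary type\<close>

text \<open>The parameter \<open>t\<close> runs from \<open>x\<close> at 0 to \<open>y\<close> at 1.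
  It may also leave the unit interval, which is what separates \<open>affine_set\<close> from
  \<open>convex_set\<close>.\<close>

definition mix :: "real \<Rightarrow> ('i \<Rightarrow> real) \<Rightarrow> ('i \<Rightarrow> real) \<Rightarrow> 'i \<Rightarrow> real" where
  "mix t x y = (\<lambda>i. (1 - t) * x i + t * y i)"

definition affine_fun :: "(('i \<Rightarrow> real) \<Rightarrow> real) \<Rightarrow> bool" where
  "affine_fun g \<longleftrightarrow> (\<forall>x y t. g (mix t x y) = (1 - t) * g x + t * g y)"

definition affine_set :: "('i \<Rightarrow> real) set \<Rightarrow> bool" where
  "affine_set A \<longleftrightarrow> (\<forall>x\<in>A. \<forall>y\<in>A. \<forall>t. mix t x y \<in> A)"

definition convex_set :: "('i \<Rightarrow> real) set \<Rightarrow> bool" where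
  "convex_set A \<longleftrightarrow> (\<forall>x\<in>A. \<forall>y\<in>A. \<forall>t. 0 \<le> t \<longrightarrow> t \<le> 1 \<longrightarrow> mix t x y \<in> A)"

definition convex_fun :: "('i \<Rightarrow> real) set \<Rightarrow> (('i \<Rightarrow> real) \<Rightarrow> real) \<Rightarrow> bool" where
  "convex_fun A f \<longleftrightarrow> (\<forall>x\<in>A. \<forall>y\<in>A. \<forall>t. 0 \<le> t \<longrightarrow> t \<le> 1 \<longrightarrow>
     f (mix t x y) \<le> (1 - t) * f x + t * f y)"

lemma affine_funD: "affine_fun g \<Longrightarrow> g (mix t x y) = (1 - t) * g x + t * g y"
  by (simp add: affine_fun_def)

lemma affine_fun_const: "affine_fun (\<lambda>x. c)"
  by (simp add: affine_fun_def algebra_simps)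

lemma affine_fun_coord: "affine_fun (\<lambda>x. x i)"
  by (simp add: affine_fun_def mix_def)

lemma affine_fun_add: "affine_fun f \<Longrightarrow> affine_fun g \<Longrightarrow> affine_fun (\<lambda>x. f x + g x)"
  by (simp add: affine_fun_def algebra_simps)

lemma affine_fun_diff: "affine_fun f \<Longrightarrow> affine_fun g \<Longrightarrow> affine_fun (\<lambda>x. f x - g x)"
  by (simp add: affine_fun_def algebra_simps)

lemma affine_fun_cmult: "affine_fun f \<Longrightarrow> affine_fun (\<lambda>x. c * f x)"
  by (simp add: affine_fun_def distrib_left mult.left_commute)

lemma affine_fun_sum:
  assumes "\<And>i. i \<in> I \<Longrightarrow> affine_fun (f i)"
  shows "affine_fun (\<lambda>x. \<Sum>i\<in>I. f i x)"
  using assms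
  by (simp add: affine_fun_def sum.distrib sum_distrib_left cong: sum.cong)

lemmas affine_fun_intros =
  affine_fun_const affine_fun_coord affine_fun_add affine_fun_diff affine_fun_cmult affine_fun_sum

lemma affine_set_Collect_zero: "affine_fun g \<Longrightarrow> affine_set {x. g x = 0}"
  by (simp add: affine_set_def affine_fun_def)

lemma affine_set_Collect_conj:
  "affine_set {x. P x} \<Longrightarrow> affine_set {x. Q x} \<Longrightarrow> affine_set {x. P x \<and> Q x}"
  by (simp add: affine_set_def)

lemma affine_set_Collect_ball: "(\<And>l. affine_set {x. P l x}) \<Longrightarrow> affine_set {x. \<forall>l\<in>L. P l x}"
  by (simp add: affine_set_def)

lemma affine_set_zeros: "affine_set A \<Longrightarrow> affine_fun g \<Longrightarrow> affine_set {x \<in> A. g x = 0}"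
  by (simp add: affine_set_def affine_fun_def)

lemma affine_set_imp_convex_set: "affine_set A \<Longrightarrow> convex_set A"
  by (simp add: affine_set_def convex_set_def)

lemma mix_le:
  assumes "a \<le> c" "b \<le> c" "0 \<le> t" "t \<le> 1"
  shows "(1 - t) * a + t * b \<le> (c :: real)"
  using convex_bound_le[of a c b "1 - t" t] assms by simp

lemma convex_set_sublevel:
  assumes "convex_set A" "\<And>i. i \<in> I \<Longrightarrow> affine_fun (g i)"
  shows "convex_set {x \<in> A. \<forall>i\<in>I. g i x \<le> c i}"
  using assms by (simp add: convex_set_def affine_fun_def mix_le)

lemma convex_fun_subset: "convex_fun B f \<Longrightarrow> A \<subseteq> B \<Longrightarrow> convex_fun A f"
  unfolding convex_fun_def by blast

lemma convex_fun_affine: "affine_fun g \<Longrightarrow> convex_fun A g"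
  by (simp add: convex_fun_def affine_fun_def)

lemma convex_fun_add:
  assumes "convex_fun A f" "convex_fun A g"
  shows "convex_fun A (\<lambda>x. f x + g x)"
  unfolding convex_fun_def
proof (intro ballI allI impI)
  fix x y :: "'a \<Rightarrow> real" and t :: real
  assume "x \<in> A" "y \<in> A" "0 \<le> t" "t \<le> 1"
  with assms have "f (mix t x y) \<le> (1 - t) * f x + t * f y" "g (mix t x y) \<le> (1 - t) * g x + t * g y"
    by (simp_all add: convex_fun_def)
  then show "f (mix t x y) + g (mix t x y) \<le> (1 - t) * (f x + g x) + t * (f y + g y)"
    by (simp add: algebra_simps)
qed

lemma convex_fun_sum:
  assumes "\<And>i. i \<in> I \<Longrightarrow> convex_fun A (f i)"
  shows "convex_fun A (\<lambda>x. \<Sum>i\<in>I. f i x)"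
proof (cases "finite I")
  case True
  then show ?thesis using assms
    by (induction I) (simp_all add: convex_fun_affine affine_fun_const convex_fun_add)
qed (simp add: convex_fun_affine affine_fun_const)

section \<open>Multipliers for convex functions under affine constraints\<close>

text \<open>Points with \<open>g > 0\<close> bound \<mu> from below by \<open>- f / g\<close>,
  points with \<open>g < 0\<close> bound it from above. Convexity on the segment between two such
  points, evaluated where \<open>g\<close> vanishes, puts every lower bound below every upper bound,
  so the supremum of the lower bounds is a multiplier.\<close>

lemma multiplier_two_sided:
  assumes C: "convex_set C" and f: "convex_fun C f" and g: "affine_fun g"
    and nonneg: "\<And>x. x \<in> C \<Longrightarrow> g x = 0 \<Longrightarrow> 0 \<le> f x"
    and pos: "\<exists>x\<in>C. g x > 0" and neg: "\<exists>x\<in>C. g x < 0"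
  shows "\<exists>\<mu>. \<forall>x\<in>C. 0 \<le> f x + \<mu> * g x"
proof -
  have slope: "- f x / g x \<le> - f y / g y" if x: "x \<in> C" "g x > 0" and y: "y \<in> C" "g y < 0" for x y
  proof -
    \<comment> \<open>The parameter at which \<open>g\<close> vanishes on the segment from
      \<open>x\<close> to \<open>y\<close>.\<close>
    define t where "t = g x / (g x - g y)"
    have t: "0 \<le> t" "t \<le> 1" "(1 - t) * (g x - g y) = - g y" "t * (g x - g y) = g x"
      using x y by (simp_all add: t_def field_simps)
    have "g (mix t x y) = 0"
      using x y by (simp add: affine_funD[OF g] t_def field_simps)
    moreover have "mix t x y \<in> C"
      using C x y t by (simp add: convex_set_def)
    ultimately have "0 \<le> f (mix t x y)" by (rule nonneg[rotated])
    also have "\<dots> \<le> (1 - t) * f x + t * f y"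
      using f x y t by (simp add: convex_fun_def)
    finally have "0 \<le> (g x - g y) * ((1 - t) * f x + t * f y)"
      using x y by simp
    also have "\<dots> = ((1 - t) * (g x - g y)) * f x + (t * (g x - g y)) * f y"
      by (simp add: algebra_simps)
    finally have "0 \<le> - g y * f x + g x * f y"
      unfolding t .
    then show ?thesis
      using x y by (simp add: field_simps)
  qed
  define L where "L = {- f x / g x |x. x \<in> C \<and> g x > 0}"
  have bdd: "bdd_above L" using neg slope unfolding L_def bdd_above_def by blast
  have ne: "L \<noteq> {}" using pos unfolding L_def by blast
  have "0 \<le> f x + Sup L * g x" if "x \<in> C" for x
  proof -
    consider "g x = 0" | "g x > 0" | "g x < 0" by linarith
    then show ?thesis
    proof cases
      case 1
      then show ?thesis using nonneg that by simp
    next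
      case 2
      then have "- f x / g x \<le> Sup L"
        using bdd that by (intro cSup_upper) (auto simp: L_def)
      then show ?thesis using 2 by (simp add: field_simps)
    next
      case 3
      then have "Sup L \<le> - f x / g x"
        using ne that slope by (intro cSup_least) (auto simp: L_def)
      then show ?thesis using 3 by (simp add: field_simps)
    qed
  qed
  then show ?thesis by blast
qed

text \<open>If \<open>g\<close> takes both signs, the two-sided lemma gives some \<mu>. When it is
  negative, \<open>f\<close> is nonnegative on all of \<open>C\<close>, also where
  \<open>g > 0\<close>, and 0 is a multiplier instead. If \<open>g\<close> is never positive, 0
  works at once.\<close>

lemma multiplier_le:
  assumes C: "convex_set C" and f: "convex_fun C f" and g: "affine_fun g"
    and nonneg: "\<And>x. x \<in> C \<Longrightarrow> g x \<le> 0 \<Longrightarrow> 0 \<le> f x"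
    and slater: "\<exists>x\<in>C. g x < 0"
  shows "\<exists>\<mu>\<ge>0. \<forall>x\<in>C. 0 \<le> f x + \<mu> * g x"
proof (cases "\<exists>x\<in>C. g x > 0")
  case True
  then obtain \<mu> where \<mu>: "\<forall>x\<in>C. 0 \<le> f x + \<mu> * g x"
    using multiplier_two_sided[OF C f g _ True slater] nonneg by fastforce
  have "\<forall>x\<in>C. 0 \<le> f x + max 0 \<mu> * g x"
  proof
    fix x assume x: "x \<in> C"
    show "0 \<le> f x + max 0 \<mu> * g x"
    proof (cases "\<mu> \<ge> 0")
      case True
      with \<mu> x show ?thesis by simp
    next
      case False
      have "0 \<le> f x"
      proof (cases "g x \<le> 0")
        case True
        then show ?thesis using nonneg x by simp
      next
        case g: False
        then have "\<mu> * g x \<le> 0" using False by (simp add: mult_nonpos_nonneg)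
        then show ?thesis using \<mu> x by force
      qed
      then show ?thesis using False by (simp add: max_def)
    qed
  qed
  then show ?thesis by (intro exI[of _ "max 0 \<mu>"]) simp
next
  case False
  then show ?thesis using nonneg by (intro exI[of _ 0]) (auto simp: not_less)
qed

text \<open>On an affine set containing a zero of \<open>g\<close>, either \<open>g\<close> vanishes
  identically or it takes both signs, so no interior point has to be assumed.\<close>

lemma multiplier_eq:
  assumes A: "affine_set A" and f: "convex_fun A f" and g: "affine_fun g"
    and nonneg: "\<And>x. x \<in> A \<Longrightarrow> g x = 0 \<Longrightarrow> 0 \<le> f x"
    and ex: "\<exists>x\<in>A. g x = 0"
  shows "\<exists>\<mu>. \<forall>x\<in>A. 0 \<le> f x + \<mu> * g x"
proof (cases "\<forall>x\<in>A. g x = 0")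
  case True
  then show ?thesis using nonneg by auto
next
  case False
  then obtain y where y: "y \<in> A" "g y \<noteq> 0" by blast
  obtain x where x: "x \<in> A" "g x = 0" using ex by blast
  \<comment> \<open>reflecting \<open>y\<close> at \<open>x\<close> changes the sign of \<open>g\<close>\<close>
  have "mix (- 1) x y \<in> A" "g (mix (- 1) x y) = - g y"
    using A x y g by (simp_all add: affine_set_def affine_funD)
  with y have "\<exists>x\<in>A. g x > 0" "\<exists>x\<in>A. g x < 0"
    by (metis neg_less_0_iff_less neg_0_less_iff_less linorder_neqE_linordered_idom)+
  with multiplier_two_sided[OF affine_set_imp_convex_set[OF A] f g] nonneg show ?thesis
    by blast
qed

text \<open>The induction hypothesis is applied on the affine subset where \<open>h j\<close>
  vanishes. The function it penalizes is then nonnegative there, so \<open>multiplier_eq\<close>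
  supplies the multiplier of \<open>h j\<close> on all of \<open>A\<close>.\<close>

lemma multipliers_eq:
  assumes "finite H" "affine_set A" "convex_fun A f" "\<And>i. i \<in> H \<Longrightarrow> affine_fun (h i)"
    and "\<exists>x\<in>A. \<forall>i\<in>H. h i x = 0"
    and "\<And>x. x \<in> A \<Longrightarrow> \<forall>i\<in>H. h i x = 0 \<Longrightarrow> 0 \<le> f x"
  shows "\<exists>\<mu>. \<forall>x\<in>A. 0 \<le> f x + (\<Sum>i\<in>H. \<mu> i * h i x)"
  using assms
proof (induction H arbitrary: A rule: finite_induct)
  case (insert j H)
  let ?B = "{x \<in> A. h j x = 0}"
  have j: "affine_fun (h j)" by (simp add: insert.prems)
  have "\<exists>\<mu>. \<forall>x\<in>?B. 0 \<le> f x + (\<Sum>i\<in>H. \<mu> i * h i x)"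
    using insert.prems j
    by (intro insert.IH affine_set_zeros) (auto intro: convex_fun_subset)
  then obtain \<mu> where \<mu>: "\<And>x. x \<in> ?B \<Longrightarrow> 0 \<le> f x + (\<Sum>i\<in>H. \<mu> i * h i x)" by blast
  have "\<exists>\<nu>. \<forall>x\<in>A. 0 \<le> (f x + (\<Sum>i\<in>H. \<mu> i * h i x)) + \<nu> * h j x"
    using insert.prems \<mu> j
    by (intro multiplier_eq convex_fun_add[OF _ convex_fun_affine] affine_fun_intros) auto
  then obtain \<nu> where \<nu>: "\<forall>x\<in>A. 0 \<le> (f x + (\<Sum>i\<in>H. \<mu> i * h i x)) + \<nu> * h j x" by blast
  have "(\<Sum>i\<in>insert j H. (\<mu>(j := \<nu>)) i * h i x) = (\<Sum>i\<in>H. \<mu> i * h i x) + \<nu> * h j x" for x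
    using insert.hyps by (simp add: add.commute) (auto intro!: sum.cong)
  with \<nu> show ?case
    by (intro exI[of _ "\<mu>(j := \<nu>)"]) (simp add: add.assoc)
qed simp

text \<open>The induction varies \<open>A\<close> and \<open>f\<close>, because the hypothesis is
  applied to \<open>f\<close> with a penalty added, to \<open>f\<close> on a smaller affine set, and
  to the constraint \<open>g j\<close> in place of \<open>f\<close>.\<close>

lemma multipliers_le:
  assumes "finite G" "affine_set A" "convex_fun A f" "\<And>i. i \<in> G \<Longrightarrow> affine_fun (g i)"
    and "\<exists>x\<in>A. \<forall>i\<in>G. g i x \<le> 0"
    and "\<And>x. x \<in> A \<Longrightarrow> \<forall>i\<in>G. g i x \<le> 0 \<Longrightarrow> 0 \<le> f x"
  shows "\<exists>\<mu>. (\<forall>i\<in>G. 0 \<le> \<mu> i) \<and> (\<forall>x\<in>A. 0 \<le> f x + (\<Sum>i\<in>G. \<mu> i * g i x))"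
  using assms
proof (induction G arbitrary: A f rule: finite_induct)
  case (insert j G)
  note A = insert.prems(1) and f = insert.prems(2)
  have j: "affine_fun (g j)" and aff: "\<And>i. i \<in> G \<Longrightarrow> affine_fun (g i)"
    by (simp_all add: insert.prems)
  let ?C = "{x \<in> A. \<forall>i\<in>G. g i x \<le> 0}"
  have C: "convex_set ?C"
    using A aff by (intro convex_set_sublevel affine_set_imp_convex_set)
  have upd: "(\<Sum>i\<in>insert j G. (if i = j then \<nu> else \<mu> i) * g i x) = (\<Sum>i\<in>G. \<mu> i * g i x) + \<nu> * g j x" for \<mu> \<nu> x
    using insert.hyps by (simp add: add.commute) (auto intro!: sum.cong)
  show ?case
  proof (cases "\<exists>x\<in>?C. g j x < 0")
    case True
    \<comment> \<open>Here \<open>g j\<close> has a Slater point within the other constraints, so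
      its multiplier is found first and absorbed into the function.\<close>
    have "\<exists>\<nu>\<ge>0. \<forall>x\<in>?C. 0 \<le> f x + \<nu> * g j x"
      using insert.prems True
      by (intro multiplier_le C j) (auto intro: convex_fun_subset)
    then obtain \<nu> where \<nu>: "\<nu> \<ge> 0" "\<And>x. x \<in> ?C \<Longrightarrow> 0 \<le> f x + \<nu> * g j x" by blast
    have "\<exists>\<mu>. (\<forall>i\<in>G. 0 \<le> \<mu> i) \<and> (\<forall>x\<in>A. 0 \<le> (f x + \<nu> * g j x) + (\<Sum>i\<in>G. \<mu> i * g i x))"
      using insert.prems \<nu>
      by (intro insert.IH convex_fun_add[OF _ convex_fun_affine] affine_fun_intros) auto
    then obtain \<mu> where "\<forall>i\<in>G. 0 \<le> \<mu> i"
      "\<forall>x\<in>A. 0 \<le> (f x + \<nu> * g j x) + (\<Sum>i\<in>G. \<mu> i * g i x)" by blast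
    then show ?thesis
      using \<nu>(1) by (intro exI[of _ "\<mu>(j := \<nu>)"]) (simp add: upd add.assoc add.commute del: sum.insert)
  next
    case False
    \<comment> \<open>Here \<open>g j\<close> is nonnegative where the other constraints hold, so it acts as an equality,
      whose multiplier \<open>\<nu>\<close> may be negative.  Nonnegativity of \<open>g j\<close> there has itself a
      certificate \<open>\<rho>\<close> by the induction hypothesis, which is used to cancel a negative \<open>\<nu>\<close>.\<close>
    let ?B = "{x \<in> A. g j x = 0}"
    \<comment> \<open>In this case a point satisfying all constraints must have
      \<open>g j = 0\<close>.\<close>
    obtain x0 where x0: "x0 \<in> A" "\<forall>i\<in>G. g i x0 \<le> 0" "g j x0 = 0"
      using insert.prems(4) False by (force simp: not_less)
    have "\<exists>\<mu>. (\<forall>i\<in>G. 0 \<le> \<mu> i) \<and> (\<forall>x\<in>?B. 0 \<le> f x + (\<Sum>i\<in>G. \<mu> i * g i x))"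
      using insert.prems j x0
      by (intro insert.IH affine_set_zeros) (auto intro: convex_fun_subset)
    then obtain \<mu> where \<mu>: "\<forall>i\<in>G. 0 \<le> \<mu> i" "\<And>x. x \<in> ?B \<Longrightarrow> 0 \<le> f x + (\<Sum>i\<in>G. \<mu> i * g i x)"
      by blast
    have "\<exists>\<nu>. \<forall>x\<in>A. 0 \<le> (f x + (\<Sum>i\<in>G. \<mu> i * g i x)) + \<nu> * g j x"
      using insert.prems \<mu> j x0
      by (intro multiplier_eq convex_fun_add[OF _ convex_fun_affine] affine_fun_intros) auto
    then obtain \<nu> where \<nu>: "\<And>x. x \<in> A \<Longrightarrow> 0 \<le> (f x + (\<Sum>i\<in>G. \<mu> i * g i x)) + \<nu> * g j x" by blast
    have "\<exists>\<rho>. (\<forall>i\<in>G. 0 \<le> \<rho> i) \<and> (\<forall>x\<in>A. 0 \<le> g j x + (\<Sum>i\<in>G. \<rho> i * g i x))"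
      using A j aff x0 False by (intro insert.IH convex_fun_affine) (auto simp: not_less)
    then obtain \<rho> where \<rho>: "\<forall>i\<in>G. 0 \<le> \<rho> i" "\<And>x. x \<in> A \<Longrightarrow> 0 \<le> g j x + (\<Sum>i\<in>G. \<rho> i * g i x)"
      by blast
    define m where "m = max 0 (- \<nu>)"
    have m: "m \<ge> 0" "\<nu> + m \<ge> 0" by (auto simp: m_def)
    have "0 \<le> f x + ((\<Sum>i\<in>G. (\<mu> i + m * \<rho> i) * g i x) + (\<nu> + m) * g j x)" if "x \<in> A" for x
    proof -
      have "0 \<le> m * (g j x + (\<Sum>i\<in>G. \<rho> i * g i x))"
        using m \<rho>(2)[OF that] by simp
      with \<nu>[OF that] show ?thesis
        by (simp add: distrib_left distrib_right sum.distrib sum_distrib_left mult.assoc)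
    qed
    then show ?thesis
      using \<mu>(1) \<rho>(1) m
      by (intro exI[of _ "(\<lambda>i. \<mu> i + m * \<rho> i)(j := \<nu> + m)"]) (simp add: upd del: sum.insert)
  qed
qed simp


lemma box_multipliers_eq:
  assumes V: "finite V" and H: "finite H" and A: "affine_set A" and f: "convex_fun A f"
    and h: "\<And>k. k \<in> H \<Longrightarrow> affine_fun (h k)"
    and ex: "\<exists>x\<in>A. (\<forall>i\<in>V. lo i \<le> x i \<and> x i \<le> hi i) \<and> (\<forall>k\<in>H. h k x = 0)"
    and nonneg: "\<And>x. x \<in> A \<Longrightarrow> \<forall>i\<in>V. lo i \<le> x i \<and> x i \<le> hi i \<Longrightarrow> \<forall>k\<in>H. h k x = 0 \<Longrightarrow> 0 \<le> f x"
  shows "\<exists>\<eta>. \<forall>x\<in>A. (\<forall>i\<in>V. lo i \<le> x i \<and> x i \<le> hi i) \<longrightarrow> 0 \<le> f x + (\<Sum>k\<in>H. \<eta> k * h k x)"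
proof -
  \<comment> \<open>The Boolean selects the upper or the lower bound, so that both form one finite
    family of inequalities.\<close>
  define g where "g = (\<lambda>(i, upper) x. if upper then x i - hi i else lo i - x i)"
  have g_aff: "affine_fun (g p)" for p
    by (cases p; cases "snd p") (auto simp: g_def intro!: affine_fun_intros)
  have g_le: "(\<forall>p\<in>V \<times> UNIV. g p x \<le> 0) \<longleftrightarrow> (\<forall>i\<in>V. lo i \<le> x i \<and> x i \<le> hi i)" for x
    by (auto simp: g_def split_def)
  let ?B = "{x \<in> A. \<forall>k\<in>H. h k x = 0}"
  have B: "affine_set ?B"
    using A h by (simp add: affine_set_def affine_fun_def)
  have "\<exists>\<mu>. (\<forall>p\<in>V \<times> UNIV. 0 \<le> \<mu> p) \<and> (\<forall>x\<in>?B. 0 \<le> f x + (\<Sum>p\<in>V \<times> UNIV. \<mu> p * g p x))"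
  proof (rule multipliers_le)
    show "convex_fun ?B f" using f by (rule convex_fun_subset) auto
    show "\<exists>x\<in>?B. \<forall>p\<in>V \<times> UNIV. g p x \<le> 0"
      unfolding g_le using ex by blast
    show "0 \<le> f x" if "x \<in> ?B" "\<forall>p\<in>V \<times> UNIV. g p x \<le> 0" for x
      using that nonneg unfolding g_le by blast
  qed (simp_all add: V B g_aff)
  then obtain \<mu> where \<mu>: "\<forall>p\<in>V \<times> UNIV. 0 \<le> \<mu> p"
    "\<forall>x\<in>?B. 0 \<le> f x + (\<Sum>p\<in>V \<times> UNIV. \<mu> p * g p x)" by blast
  have "\<exists>\<eta>. \<forall>x\<in>A. 0 \<le> (f x + (\<Sum>p\<in>V \<times> UNIV. \<mu> p * g p x)) + (\<Sum>k\<in>H. \<eta> k * h k x)"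
    using \<mu>(2) ex
    by (intro multipliers_eq H A convex_fun_add[OF f convex_fun_affine] affine_fun_intros g_aff h) auto
  then obtain \<eta> where \<eta>:
    "\<forall>x\<in>A. 0 \<le> (f x + (\<Sum>p\<in>V \<times> UNIV. \<mu> p * g p x)) + (\<Sum>k\<in>H. \<eta> k * h k x)" by blast
  have "0 \<le> f x + (\<Sum>k\<in>H. \<eta> k * h k x)" if "x \<in> A" "\<forall>i\<in>V. lo i \<le> x i \<and> x i \<le> hi i" for x
  proof -
    have "(\<Sum>p\<in>V \<times> UNIV. \<mu> p * g p x) \<le> 0"
      using \<mu>(1) that(2) unfolding g_le[symmetric]
      by (intro sum_nonpos) (blast intro: mult_nonneg_nonpos)
    then show ?thesis using \<eta> that(1) by force
  qed
  then show ?thesis by blast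
qed

text \<open>Coordinates outside \<open>V\<close> are unbounded but do not matter by
  \<open>dep\<close>. Resetting them to 0 turns the box into a product of compact sets, which is
  compact by Tychonoff's theorem.\<close>

lemma attains_min_on_box:
  fixes f :: "('i \<Rightarrow> real) \<Rightarrow> real"
  assumes A: "closed A" and f: "continuous_on UNIV f"
    and dep: "\<And>x y. \<forall>i\<in>V. x i = y i \<Longrightarrow> x \<in> A \<Longrightarrow> y \<in> A \<and> f x = f y"
    and ex: "\<exists>x\<in>A. \<forall>i\<in>V. lo i \<le> x i \<and> x i \<le> hi i"
  shows "\<exists>x\<in>A. (\<forall>i\<in>V. lo i \<le> x i \<and> x i \<le> hi i) \<and>
           (\<forall>y\<in>A. (\<forall>i\<in>V. lo i \<le> y i \<and> y i \<le> hi i) \<longrightarrow> f x \<le> f y)"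
proof -
  define S where "S = (\<lambda>i. if i \<in> V then {lo i..hi i} else {0})"
  have "compactin (product_topology (\<lambda>_. euclidean) UNIV) (PiE UNIV S)"
    unfolding compactin_PiE by (simp add: S_def)
  then have "compact (PiE UNIV S)"
    by (simp add: euclidean_product_topology)
  then have K: "compact (PiE UNIV S \<inter> A)"
    using A by (rule compact_Int_closed)
  define cut where "cut = (\<lambda>x i. if i \<in> V then x i else 0 :: real)"
  have cut: "cut y \<in> PiE UNIV S \<inter> A" "f (cut y) = f y"
    if "y \<in> A" "\<forall>i\<in>V. lo i \<le> y i \<and> y i \<le> hi i" for y
    using that dep[of y "cut y"] by (auto simp: cut_def S_def)
  from ex cut have "PiE UNIV S \<inter> A \<noteq> {}" by blast
  from continuous_attains_inf[OF K this continuous_on_subset[OF f]]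
  obtain x where x: "x \<in> PiE UNIV S \<inter> A" "\<forall>y\<in>PiE UNIV S \<inter> A. f x \<le> f y" by auto
  have "lo i \<le> x i \<and> x i \<le> hi i" if "i \<in> V" for i
    using x(1) that by (auto simp: S_def PiE_iff dest!: spec[of _ i])
  with x cut show ?thesis by (metis IntD2)
qed

section \<open>Problem (C) as equations and bounds on a single vector\<close>

datatype ('b, 'g, 'e, 'k) var =
  Demand 'k | Trade 'k | Gas 'g | Charge 'e | Discharge 'e
  | FlowP "'b \<times> 'b" | FlowQ "'b \<times> 'b" | Volt 'b

text \<open>The power balance of every customer reads \<open>q k = d k + offset M k\<close>.\<close>

definition offset :: "('b, 'g, 'e, 'k) market \<Rightarrow> 'k \<Rightarrow> real" where
  "offset M k = (if k \<in> consumers M then fixed_demand M k else fixed_demand M k - renewable M k)"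

text \<open>
  The bounds on \<open>Trade\<close> follow from power balance; they make the feasible set of (C) compact, but
  are no constraints of \<open>\<F>\<^sub>c\<close> and must not enter the Lagrangian.
\<close>

primrec var_min :: "('b, 'g, 'e, 'k) market \<Rightarrow> ('b, 'g, 'e, 'k) var \<Rightarrow> real" where
  "var_min M (Demand k) = demand_min M k"
| "var_min M (Trade k) = demand_min M k + offset M k"
| "var_min M (Gas g) = - gas_reserve M g"
| "var_min M (Charge e) = charge_min M e"
| "var_min M (Discharge e) = discharge_min M e"
| "var_min M (FlowP l) = - line_P_max M l"
| "var_min M (FlowQ l) = - line_Q_max M l"
| "var_min M (Volt b) = volt_min M b"

primrec var_max :: "('b, 'g, 'e, 'k) market \<Rightarrow> ('b, 'g, 'e, 'k) var \<Rightarrow> real" where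
  "var_max M (Demand k) = demand_max M k"
| "var_max M (Trade k) = demand_max M k + offset M k"
| "var_max M (Gas g) = gas_reserve M g"
| "var_max M (Charge e) = charge_max M e"
| "var_max M (Discharge e) = discharge_max M e"
| "var_max M (FlowP l) = line_P_max M l"
| "var_max M (FlowQ l) = line_Q_max M l"
| "var_max M (Volt b) = volt_max M b"

definition in_bounds ::
  "('b, 'g, 'e, 'k) market \<Rightarrow> ('b, 'g, 'e, 'k) var set \<Rightarrow> (('b, 'g, 'e, 'k) var \<Rightarrow> real) \<Rightarrow> bool" where
  "in_bounds M V x \<longleftrightarrow> (\<forall>i\<in>V. var_min M i \<le> x i \<and> x i \<le> var_max M i)"

text \<open>\<open>Demand\<close> and \<open>Trade\<close> are left out: \<F>c places no bounds
  directly on them.\<close>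

definition network_vars :: "('b, 'g, 'e, 'k) market \<Rightarrow> ('b, 'g, 'e, 'k) var set" where
  "network_vars M = Gas ` gas_units M \<union> Charge ` storages M \<union> Discharge ` storages M \<union>
     FlowP ` lines M \<union> FlowQ ` lines M \<union> Volt ` nodes M"

text \<open>Nodal net loads are determined by the other variables, so they are eliminated instead of
  being coordinates, which would have no bounds of their own.\<close>

definition net_P ::
  "('b, 'g, 'e, 'k) market \<Rightarrow> (('b, 'g, 'e, 'k) var \<Rightarrow> real) \<Rightarrow> 'b \<Rightarrow> real" where
  "net_P M x b = load_P M b
     - (\<Sum>g\<in>{g \<in> gas_units M. gas_node M g = b}. gas_P M g + x (Gas g))
     + (\<Sum>k\<in>{k \<in> customers M. customer_node M k = b}. x (Trade k))
     - (\<Sum>e\<in>{e \<in> storages M. storage_node M e = b}. x (Discharge e) - x (Charge e))"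

definition net_Q :: "('b, 'g, 'e, 'k) market \<Rightarrow> 'b \<Rightarrow> real" where
  "net_Q M b = load_Q M b - (\<Sum>g\<in>{g \<in> gas_units M. gas_node M g = b}. gas_Q M g)"

text \<open>Every equation has the form "affine function = 0", the shape that
  \<open>affine_set_Collect_zero\<close> needs. The inequalities are kept apart in
  \<open>in_bounds\<close>.\<close>

definition flow_eqs ::
  "('b, 'g, 'e, 'k) market \<Rightarrow> (('b, 'g, 'e, 'k) var \<Rightarrow> real) \<Rightarrow> bool" where
  "flow_eqs M x \<longleftrightarrow>
     (\<forall>l\<in>lines M.
        x (FlowP l) - net_P M x (snd l) - (\<Sum>m\<in>{m. (snd l, m) \<in> lines M}. x (FlowP (snd l, m))) = 0 \<and>
        x (FlowQ l) - net_Q M (snd l) - (\<Sum>m\<in>{m. (snd l, m) \<in> lines M}. x (FlowQ (snd l, m))) = 0 \<and>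
        x (Volt (fst l)) - (line_r M l * x (FlowP l) + line_x M l * x (FlowQ l)) - x (Volt (snd l)) = 0) \<and>
     x (Volt (root M)) - volt_root M = 0"

lemma affine_fun_net_P: "affine_fun (\<lambda>x. net_P M x b)"
  unfolding net_P_def by (intro affine_fun_intros)

lemma affine_set_flow_eqs: "affine_set {x. flow_eqs M x}"
  unfolding flow_eqs_def
  by (intro affine_set_Collect_conj affine_set_Collect_ball affine_set_Collect_zero
      affine_fun_intros affine_fun_net_P)

lemma closed_flow_eqs: "closed {x. flow_eqs M x}"
  unfolding flow_eqs_def net_P_def Ball_def
  by (intro closed_Collect_conj closed_Collect_all closed_Collect_imp closed_Collect_eq
      continuous_intros open_Collect_const) auto

section \<open>The network set as a projection, and its convexity\<close>

context energy_sharing_market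
begin

lemma finite_customers: "finite (customers M)"
  by (simp add: customers_def finite_consumers finite_prosumers)

lemma finite_network_vars: "finite (network_vars M)"
  using finite_subset[OF lines_nodes] finite_nodes finite_gas_units finite_storages
  by (simp add: network_vars_def)

lemma power_balance_iff: "k \<in> customers M \<Longrightarrow> power_balance M k d q \<longleftrightarrow> q = d + offset M k"
  using disjoint by (auto simp: power_balance_def offset_def customers_def)

lemma lagrangian_eq:
  "lagrangian M \<eta> d q = total_disutility M d + (\<Sum>k\<in>customers M. \<eta> k * (d k + offset M k - q k))"
proof -
  have "(\<Sum>k\<in>prosumers M. \<eta> k * (d k + fixed_demand M k - renewable M k - q k)) =
      (\<Sum>k\<in>prosumers M. \<eta> k * (d k + offset M k - q k))"
    using disjoint by (intro sum.cong) (auto simp: offset_def)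
  moreover have "(\<Sum>k\<in>consumers M. \<eta> k * (d k + fixed_demand M k - q k)) =
      (\<Sum>k\<in>consumers M. \<eta> k * (d k + offset M k - q k))"
    by (simp add: offset_def)
  ultimately show ?thesis
    using disjoint finite_consumers finite_prosumers
    by (simp add: lagrangian_def customers_def sum.union_disjoint)
qed

text \<open>Demands do not enter the network constraints, so the \<open>Demand\<close> coordinates
  can be prescribed as an arbitrary \<open>d\<close>. One vector then represents any pair of
  arguments of the Lagrangian.\<close>

lemma network_set_witness:
  assumes "q \<in> network_set M"
  obtains x where "flow_eqs M x" "in_bounds M (network_vars M) x"
    "\<And>k. x (Trade k) = q k" "\<And>k. x (Demand k) = d k"
proof -
  from assms obtain DP pc pd P Q PL QL v where
    gas: "\<forall>g\<in>gas_units M. - gas_reserve M g \<le> DP g \<and> DP g \<le> gas_reserve M g" and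
    P: "\<forall>b\<in>nodes M. P b = load_P M b
         - (\<Sum>g\<in>{g \<in> gas_units M. gas_node M g = b}. gas_P M g + DP g)
         + (\<Sum>k\<in>{k \<in> customers M. customer_node M k = b}. q k)
         - (\<Sum>e\<in>{e \<in> storages M. storage_node M e = b}. pd e - pc e)" and
    Q: "\<forall>b\<in>nodes M. Q b = load_Q M b
         - (\<Sum>g\<in>{g \<in> gas_units M. gas_node M g = b}. gas_Q M g)" and
    flow: "\<forall>(n, b)\<in>lines M.
         PL (n, b) - P b - (\<Sum>m\<in>{m. (b, m) \<in> lines M}. PL (b, m)) = 0 \<and>
         QL (n, b) - Q b - (\<Sum>m\<in>{m. (b, m) \<in> lines M}. QL (b, m)) = 0" and
    cap: "\<forall>(n, b)\<in>lines M.
         - line_P_max M (n, b) \<le> PL (n, b) \<and> PL (n, b) \<le> line_P_max M (n, b) \<and>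
         - line_Q_max M (n, b) \<le> QL (n, b) \<and> QL (n, b) \<le> line_Q_max M (n, b)" and
    drop: "\<forall>(n, b)\<in>lines M.
         v n - (line_r M (n, b) * PL (n, b) + line_x M (n, b) * QL (n, b)) = v b" and
    volt: "\<forall>b\<in>nodes M. volt_min M b \<le> v b \<and> v b \<le> volt_max M b" "v (root M) = volt_root M" and
    stor: "\<forall>e\<in>storages M.
         charge_min M e \<le> pc e \<and> pc e \<le> charge_max M e \<and>
         discharge_min M e \<le> pd e \<and> pd e \<le> discharge_max M e"
    unfolding network_set_def mem_Collect_eq by (elim exE conjE) (rule that)
  define x where "x = case_var d q DP pc pd PL QL v"
  have "flow_eqs M x"
    unfolding flow_eqs_def
  proof (intro conjI ballI)
    fix l assume l: "l \<in> lines M"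
    obtain n b where nb: "l = (n, b)" by (cases l)
    have b: "b \<in> nodes M" using l lines_nodes nb by auto
    have "net_P M x b = P b" "net_Q M b = Q b"
      using P Q b by (simp_all add: net_P_def net_Q_def x_def)
    then show "x (FlowP l) - net_P M x (snd l) - (\<Sum>m\<in>{m. (snd l, m) \<in> lines M}. x (FlowP (snd l, m))) = 0"
      "x (FlowQ l) - net_Q M (snd l) - (\<Sum>m\<in>{m. (snd l, m) \<in> lines M}. x (FlowQ (snd l, m))) = 0"
      using flow l nb by (auto simp: x_def)
    show "x (Volt (fst l)) - (line_r M l * x (FlowP l) + line_x M l * x (FlowQ l)) - x (Volt (snd l)) = 0"
      using drop l nb by (auto simp: x_def)
  qed (use volt in \<open>simp add: x_def\<close>)
  moreover have "in_bounds M (network_vars M) x"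
    using gas cap volt stor by (auto simp: in_bounds_def network_vars_def x_def)
  ultimately show ?thesis
    by (rule that) (simp_all add: x_def)
qed

text \<open>The eliminated nodal loads are recovered as \<open>net_P\<close> and
  \<open>net_Q\<close>. Agreement of \<open>q\<close> with \<open>Trade\<close> is asked on
  customers only, which yields \<open>network_set_cong\<close>.\<close>

lemma network_setI:
  assumes flow: "flow_eqs M x" and bnd: "in_bounds M (network_vars M) x"
    and q: "\<And>k. k \<in> customers M \<Longrightarrow> q k = x (Trade k)"
  shows "q \<in> network_set M"
proof -
  have "(\<Sum>k\<in>{k \<in> customers M. customer_node M k = b}. q k) =
      (\<Sum>k\<in>{k \<in> customers M. customer_node M k = b}. x (Trade k))" for b
    using q by (intro sum.cong) auto
  then have P: "net_P M x b = load_P M b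
      - (\<Sum>g\<in>{g \<in> gas_units M. gas_node M g = b}. gas_P M g + x (Gas g))
      + (\<Sum>k\<in>{k \<in> customers M. customer_node M k = b}. q k)
      - (\<Sum>e\<in>{e \<in> storages M. storage_node M e = b}. x (Discharge e) - x (Charge e))" for b
    by (simp add: net_P_def)
  have eqs: "x (FlowP (n, b)) - net_P M x b - (\<Sum>m\<in>{m. (b, m) \<in> lines M}. x (FlowP (b, m))) = 0"
    "x (FlowQ (n, b)) - net_Q M b - (\<Sum>m\<in>{m. (b, m) \<in> lines M}. x (FlowQ (b, m))) = 0"
    "x (Volt n) - (line_r M (n, b) * x (FlowP (n, b)) + line_x M (n, b) * x (FlowQ (n, b))) = x (Volt b)"
    if "(n, b) \<in> lines M" for n b
    using flow[unfolded flow_eqs_def, THEN conjunct1, rule_format, OF that] by simp_all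
  have root: "x (Volt (root M)) = volt_root M"
    using flow by (simp add: flow_eqs_def)
  have bounds:
    "\<And>g. g \<in> gas_units M \<Longrightarrow> - gas_reserve M g \<le> x (Gas g) \<and> x (Gas g) \<le> gas_reserve M g"
    "\<And>e. e \<in> storages M \<Longrightarrow> charge_min M e \<le> x (Charge e) \<and> x (Charge e) \<le> charge_max M e"
    "\<And>e. e \<in> storages M \<Longrightarrow> discharge_min M e \<le> x (Discharge e) \<and> x (Discharge e) \<le> discharge_max M e"
    "\<And>l. l \<in> lines M \<Longrightarrow> - line_P_max M l \<le> x (FlowP l) \<and> x (FlowP l) \<le> line_P_max M l"
    "\<And>l. l \<in> lines M \<Longrightarrow> - line_Q_max M l \<le> x (FlowQ l) \<and> x (FlowQ l) \<le> line_Q_max M l"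
    "\<And>b. b \<in> nodes M \<Longrightarrow> volt_min M b \<le> x (Volt b) \<and> x (Volt b) \<le> volt_max M b"
    using bnd by (auto simp: in_bounds_def network_vars_def ball_Un)
  show ?thesis
    unfolding network_set_def mem_Collect_eq
    apply (rule exI[of _ "\<lambda>g. x (Gas g)"], rule exI[of _ "\<lambda>e. x (Charge e)"],
        rule exI[of _ "\<lambda>e. x (Discharge e)"], rule exI[of _ "net_P M x"], rule exI[of _ "net_Q M"],
        rule exI[of _ "\<lambda>l. x (FlowP l)"], rule exI[of _ "\<lambda>l. x (FlowQ l)"],
        rule exI[of _ "\<lambda>b. x (Volt b)"])
    apply (intro conjI)
    subgoal using bounds by blast
    subgoal by (intro ballI P)
    subgoal by (intro ballI net_Q_def)
    subgoal unfolding Ball_def split_paired_All prod.case using eqs by blast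
    subgoal unfolding Ball_def split_paired_All prod.case using bounds by blast
    subgoal unfolding Ball_def split_paired_All prod.case using eqs by blast
    subgoal using bounds by blast
    subgoal by (rule root)
    subgoal using bounds by blast
    done
qed

lemma network_set_cong:
  assumes "q \<in> network_set M" "\<And>k. k \<in> customers M \<Longrightarrow> q' k = q k"
  shows "q' \<in> network_set M"
  using network_set_witness[OF assms(1)] network_setI assms(2) by metis

lemma convex_network_set: "convex_set (network_set M)"
  unfolding convex_set_def
proof (intro ballI allI impI)
  fix q q' and t :: real
  assume q: "q \<in> network_set M" "q' \<in> network_set M" and t: "0 \<le> t" "t \<le> 1"
  obtain x where x: "flow_eqs M x" "in_bounds M (network_vars M) x" "\<And>k. x (Trade k) = q k"
    using network_set_witness[OF q(1)] by metis
  obtain y where y: "flow_eqs M y" "in_bounds M (network_vars M) y" "\<And>k. y (Trade k) = q' k"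
    using network_set_witness[OF q(2)] by metis
  show "mix t q q' \<in> network_set M"
  proof (rule network_setI)
    show "flow_eqs M (mix t x y)"
      using affine_set_flow_eqs[of M] x y by (simp add: affine_set_def)
    have "a \<le> (1 - t) * u + t * v" if "a \<le> u" "a \<le> v" for a u v :: real
      using mix_le[of "- u" "- a" "- v" t] that t by simp
    then show "in_bounds M (network_vars M) (mix t x y)"
      using x(2) y(2) t by (simp add: in_bounds_def mix_def mix_le)
  qed (simp add: x y mix_def)
qed

lemma strictly_convex_combination:
  assumes "k \<in> customers M" "x \<noteq> y" "0 < t" "t < 1"
  shows "disutility M k ((1 - t) * x + t * y) < (1 - t) * disutility M k x + t * disutility M k y"
proof -
  have "0 < 1 - t" "1 - t + t = 1" using assms by simp_all
  with disutility[OF assms(1)] assms(2,3) show ?thesis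
    unfolding strictly_convex_def by blast
qed

text \<open>Convexity on the whole line also gives the continuity of the disutilities, which the
  existence of a minimizer needs.\<close>

lemma convex_on_disutility:
  assumes "k \<in> customers M"
  shows "convex_on UNIV (disutility M k)"
proof (rule convex_onI)
  fix t x y :: real
  assume "0 < t" "t < 1"
  then show "disutility M k ((1 - t) *\<^sub>R x + t *\<^sub>R y) \<le> (1 - t) * disutility M k x + t * disutility M k y"
    using strictly_convex_combination[OF assms, of x y t]
    by (cases "x = y") (simp_all add: algebra_simps)
qed simp

section \<open>Saddle points of the Lagrangian and their existence\<close>

text \<open>The Lagrangian is separable: minimizing it over demands and \<F>c means that each
  customer minimizes disutility plus \<open>\<eta> k * d k\<close>, while \<open>q\<close> maximizes
  the pairing with \<eta> over \<F>c.\<close>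

definition saddle_point :: "('k \<Rightarrow> real) \<Rightarrow> ('k \<Rightarrow> real) \<Rightarrow> ('k \<Rightarrow> real) \<Rightarrow> bool" where
  "saddle_point d q \<eta> \<longleftrightarrow>
     (\<forall>k\<in>customers M. d k \<in> {demand_min M k..demand_max M k} \<and> q k = d k + offset M k \<and>
        (\<forall>y\<in>{demand_min M k..demand_max M k}.
           disutility M k (d k) + \<eta> k * d k \<le> disutility M k y + \<eta> k * y)) \<and>
     q \<in> network_set M \<and>
     (\<forall>q'\<in>network_set M. (\<Sum>k\<in>customers M. \<eta> k * q' k) \<le> (\<Sum>k\<in>customers M. \<eta> k * q k))"

lemma saddle_point_exists:
  assumes "central_feasible M (d0, q0)"
  shows "\<exists>d q \<eta>. saddle_point d q \<eta>"
proof -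
  define f where "f = (\<lambda>x. \<Sum>k\<in>customers M. disutility M k (x (Demand k :: ('b, 'g, 'e, 'k) var)))"
  define h where "h = (\<lambda>k x. x (Demand k :: ('b, 'g, 'e, 'k) var) + offset M k - x (Trade k))"
  define V where "V = network_vars M \<union> Demand ` customers M"
  define V' where "V' = V \<union> Trade ` customers M"
  define A where "A = {x. flow_eqs M x \<and> (\<forall>k\<in>customers M. h k x = 0)}"
  \<comment> \<open>\<open>V'\<close> serves compactness and \<open>V\<close> the multipliers. They
    give the same feasible set, because power balance turns demand bounds into trade bounds.\<close>
  have in_V': "in_bounds M V' x \<longleftrightarrow> in_bounds M V x" if "x \<in> A" for x
  proof -
    have "x (Trade k) = x (Demand k) + offset M k" if "k \<in> customers M" for k
      using \<open>x \<in> A\<close> that by (simp add: A_def h_def)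
    then show ?thesis
      by (auto simp: V'_def V_def in_bounds_def ball_Un)
  qed
  have h: "affine_fun (h k)" for k
    unfolding h_def by (intro affine_fun_intros)
  have "closed A"
    unfolding A_def h_def Ball_def
    by (intro closed_Collect_conj closed_flow_eqs closed_Collect_all closed_Collect_imp
        closed_Collect_eq continuous_intros open_Collect_const) auto
  moreover have "continuous_on UNIV f"
    unfolding f_def
  proof (rule continuous_on_sum)
    fix k assume "k \<in> customers M"
    then have "continuous_on UNIV (disutility M k)"
      by (intro convex_on_continuous convex_on_disutility) auto
    then show "continuous_on UNIV (\<lambda>x. disutility M k (x (Demand k :: ('b, 'g, 'e, 'k) var)))"
      by (rule continuous_on_compose2) auto
  qed
  \<comment> \<open>The constraints and the objective read only coordinates in \<open>V'\<close>;
    for voltages this holds because the root and the ends of lines are nodes.\<close>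
  moreover have "y \<in> A \<and> f x = f y" if eq: "\<forall>i\<in>V'. x i = y i" and x: "x \<in> A" for x y
  proof -
    have eqs: "\<And>k. k \<in> customers M \<Longrightarrow> x (Demand k) = y (Demand k)"
      "\<And>k. k \<in> customers M \<Longrightarrow> x (Trade k) = y (Trade k)"
      "\<And>g. g \<in> gas_units M \<Longrightarrow> x (Gas g) = y (Gas g)"
      "\<And>e. e \<in> storages M \<Longrightarrow> x (Charge e) = y (Charge e)"
      "\<And>e. e \<in> storages M \<Longrightarrow> x (Discharge e) = y (Discharge e)"
      "\<And>l. l \<in> lines M \<Longrightarrow> x (FlowP l) = y (FlowP l)"
      "\<And>l. l \<in> lines M \<Longrightarrow> x (FlowQ l) = y (FlowQ l)"
      "\<And>n. n \<in> nodes M \<Longrightarrow> x (Volt n) = y (Volt n)"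
      using eq by (auto simp: V'_def V_def network_vars_def)
    have P: "net_P M x b = net_P M y b" for b
      unfolding net_P_def
      by (intro arg_cong2[where f = "(-)"] arg_cong2[where f = "(+)"] sum.cong refl)
        (auto intro: eqs)
    have flows: "(\<Sum>m\<in>{m. (b, m) \<in> lines M}. x (FlowP (b, m))) = (\<Sum>m\<in>{m. (b, m) \<in> lines M}. y (FlowP (b, m)))"
      "(\<Sum>m\<in>{m. (b, m) \<in> lines M}. x (FlowQ (b, m))) = (\<Sum>m\<in>{m. (b, m) \<in> lines M}. y (FlowQ (b, m)))" for b
      by (auto intro!: sum.cong eqs)
    have nodes: "fst l \<in> nodes M" "snd l \<in> nodes M" if "l \<in> lines M" for l
      using lines_nodes that by auto
    have "flow_eqs M x \<longleftrightarrow> flow_eqs M y"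
      unfolding flow_eqs_def P flows
      by (intro arg_cong2[where f = "(\<and>)"] ball_cong refl) (simp_all add: eqs nodes root_node)
    then show ?thesis
      using x eqs by (simp add: A_def h_def f_def)
  qed
  moreover have "\<exists>x\<in>A. in_bounds M V' x"
  proof -
    have fs: "\<forall>k\<in>customers M. q0 k = d0 k + offset M k"
      "\<forall>k\<in>customers M. demand_min M k \<le> d0 k \<and> d0 k \<le> demand_max M k" "q0 \<in> network_set M"
      using assms by (auto simp: central_feasible_def power_balance_iff)
    obtain x where "flow_eqs M x" "in_bounds M (network_vars M) x"
      "\<And>k. x (Trade k) = q0 k" "\<And>k. x (Demand k) = d0 k"
      using network_set_witness[OF fs(3)] by blast
    then have "x \<in> A" "in_bounds M V x"
      using fs by (auto simp: A_def h_def V_def in_bounds_def)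
    then show ?thesis using in_V' by blast
  qed
  ultimately obtain x where x: "x \<in> A" "in_bounds M V' x"
    and min: "\<And>y. y \<in> A \<Longrightarrow> in_bounds M V' y \<Longrightarrow> f x \<le> f y"
    using attains_min_on_box[of A f V' "var_min M" "var_max M"] unfolding in_bounds_def by blast
  have xV: "in_bounds M V x" using x in_V' by blast
  let ?F = "{x. flow_eqs M x}"
  \<comment> \<open>Only the balance equations \<open>h\<close> are dualized; flow equations and
    bounds remain set constraints, as in the Lagrangian. Subtracting the optimal value
    \<open>f x\<close> makes the function nonnegative at feasible points.\<close>
  have "\<exists>\<eta>. \<forall>y\<in>?F. (\<forall>i\<in>V. var_min M i \<le> y i \<and> y i \<le> var_max M i) \<longrightarrow>
      0 \<le> (f y + - f x) + (\<Sum>k\<in>customers M. \<eta> k * h k y)"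
  proof (rule box_multipliers_eq)
    show "finite V" "finite (customers M)"
      by (simp_all add: V_def finite_network_vars finite_customers)
    have "convex_fun ?F (\<lambda>x. disutility M k (x (Demand k)))" if "k \<in> customers M" for k
      using convex_onD[OF convex_on_disutility[OF that]] by (simp add: convex_fun_def mix_def)
    then show "convex_fun ?F (\<lambda>y. f y + - f x)"
      unfolding f_def
      by (intro convex_fun_add[OF _ convex_fun_affine] convex_fun_sum affine_fun_const)
    show "\<exists>x\<in>?F. (\<forall>i\<in>V. var_min M i \<le> x i \<and> x i \<le> var_max M i) \<and> (\<forall>k\<in>customers M. h k x = 0)"
      using x(1) xV by (auto simp: A_def in_bounds_def)
    show "0 \<le> f y + - f x"
      if "y \<in> ?F" "\<forall>i\<in>V. var_min M i \<le> y i \<and> y i \<le> var_max M i" "\<forall>k\<in>customers M. h k y = 0" for y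
    proof -
      have "y \<in> A" "in_bounds M V y"
        using that by (auto simp: A_def in_bounds_def)
      then show ?thesis using min in_V' by force
    qed
  qed (simp_all add: affine_set_flow_eqs h)
  then obtain \<eta> where mult: "\<forall>y\<in>?F. (\<forall>i\<in>V. var_min M i \<le> y i \<and> y i \<le> var_max M i) \<longrightarrow>
      0 \<le> (f y + - f x) + (\<Sum>k\<in>customers M. \<eta> k * h k y)" by (elim exE)
  have \<eta>: "f x \<le> f y + (\<Sum>k\<in>customers M. \<eta> k * h k y)"
    if "flow_eqs M y" "in_bounds M V y" for y
    using bspec[OF mult, of y] that by (simp add: in_bounds_def)
  define d where "d = (\<lambda>k. x (Demand k))"
  define q where "q = (\<lambda>k. x (Trade k))"
  have d: "demand_min M k \<le> d k \<and> d k \<le> demand_max M k \<and> q k = d k + offset M k"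
    if "k \<in> customers M" for k
    using x(1) xV that by (auto simp: A_def h_def d_def q_def V_def in_bounds_def ball_Un)
  have q: "q \<in> network_set M"
    using x(1) xV by (intro network_setI) (auto simp: A_def V_def in_bounds_def q_def)
  have saddle: "total_disutility M d \<le>
      total_disutility M d' + (\<Sum>k\<in>customers M. \<eta> k * (d' k + offset M k - q' k))"
    if d': "\<forall>k\<in>customers M. demand_min M k \<le> d' k \<and> d' k \<le> demand_max M k"
      and q': "q' \<in> network_set M" for d' q'
  proof -
    obtain y where y: "flow_eqs M y" "in_bounds M (network_vars M) y"
      "\<And>k. y (Trade k) = q' k" "\<And>k. y (Demand k) = d' k"
      using network_set_witness[OF q'] by blast
    then have "in_bounds M V y" using d' by (auto simp: V_def in_bounds_def)
    from \<eta>[OF y(1) this] show ?thesis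
      by (simp add: f_def h_def d_def total_disutility_def y)
  qed
  \<comment> \<open>Changing the demand of customer \<open>k\<close> alone, with \<open>q\<close>
    fixed, isolates that customer's problem.\<close>
  have "disutility M k (d k) + \<eta> k * d k \<le> disutility M k z + \<eta> k * z"
    if k: "k \<in> customers M" and z: "z \<in> {demand_min M k..demand_max M k}" for k z
  proof -
    have "total_disutility M d \<le> total_disutility M (d(k := z)) +
        (\<Sum>j\<in>customers M. \<eta> j * ((d(k := z)) j + offset M j - q j))"
      using d z by (intro saddle q) auto
    also have "(\<Sum>j\<in>customers M. \<eta> j * ((d(k := z)) j + offset M j - q j)) =
        (\<Sum>j\<in>customers M. if j = k then \<eta> k * (z - d k) else 0)"
      using d by (intro sum.cong) auto
    also have "\<dots> = \<eta> k * (z - d k)"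
      using k finite_customers by simp
    finally show ?thesis
      using k finite_customers
      by (simp add: total_disutility_def sum.remove[of _ k] algebra_simps)
  qed
  \<comment> \<open>Changing \<open>q\<close> alone, with \<open>d\<close> fixed, isolates the
    maximization over \<F>c.\<close>
  moreover have "(\<Sum>k\<in>customers M. \<eta> k * q' k) \<le> (\<Sum>k\<in>customers M. \<eta> k * q k)"
    if "q' \<in> network_set M" for q'
  proof -
    have "0 \<le> (\<Sum>k\<in>customers M. \<eta> k * (d k + offset M k - q' k))"
      using saddle[of d q'] d that by simp
    also have "\<dots> = (\<Sum>k\<in>customers M. \<eta> k * q k - \<eta> k * q' k)"
      using d by (intro sum.cong) (auto simp: algebra_simps)
    finally show ?thesis by (simp add: sum_subtractf)
  qed
  ultimately have "saddle_point d q \<eta>"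
    using d q by (simp add: saddle_point_def)
  then show ?thesis by blast
qed

section \<open>Equilibria as saddle points\<close>

text \<open>The constraints determine \<open>q\<close> and \<open>b\<close> from \<open>d\<close>,
  and paying for \<open>q\<close> instead of \<open>d\<close> shifts the cost by a constant.\<close>

lemma customer_optimal_iff:
  assumes k: "k \<in> customers M"
  shows "customer_optimal M k p (d, b, q) \<longleftrightarrow>
    d \<in> {demand_min M k..demand_max M k} \<and> q = d + offset M k \<and> b = q + sensitivity M * p \<and>
    (\<forall>y\<in>{demand_min M k..demand_max M k}. disutility M k d + p * d \<le> disutility M k y + p * y)"
    (is "?L \<longleftrightarrow> ?R")
proof
  assume L: ?L
  have opt: "disutility M k d + p * q \<le> disutility M k y + p * (y + offset M k)"
    if "y \<in> {demand_min M k..demand_max M k}" for y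
    using L[unfolded customer_optimal_def is_arg_min_linorder, THEN conjunct2, rule_format,
        of "(y, y + offset M k + sensitivity M * p, y + offset M k)"] that k
    by (simp add: power_balance_iff)
  have d: "q = d + offset M k" "b = q + sensitivity M * p" "d \<in> {demand_min M k..demand_max M k}"
    using L k unfolding customer_optimal_def is_arg_min_linorder by (auto simp: power_balance_iff)
  have "disutility M k d + p * d \<le> disutility M k y + p * y"
    if "y \<in> {demand_min M k..demand_max M k}" for y
    using opt[OF that] d(1) by (simp add: algebra_simps)
  with d show ?R by blast
next
  assume ?R
  then show ?L
    using k unfolding customer_optimal_def is_arg_min_linorder
    by (auto simp: power_balance_iff algebra_simps)
qed

text \<open>The operator projects onto a convex set; this is the variational inequality of the projection.\<close>

lemma operator_optimal_iff:
  "operator_optimal M b p \<longleftrightarrow>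
    (\<lambda>k. - sensitivity M * p k + b k) \<in> network_set M \<and>
    (\<forall>q\<in>network_set M. (\<Sum>k\<in>customers M. p k * q k) \<le>
       (\<Sum>k\<in>customers M. p k * (- sensitivity M * p k + b k)))"
    (is "?L \<longleftrightarrow> ?q \<in> _ \<and> ?R")
proof
  assume L: ?L
  then have q: "?q \<in> network_set M"
    and opt: "\<And>p'. (\<lambda>k. - sensitivity M * p' k + b k) \<in> network_set M \<Longrightarrow>
      (\<Sum>k\<in>customers M. (p k)\<^sup>2) \<le> (\<Sum>k\<in>customers M. (p' k)\<^sup>2)"
    unfolding operator_optimal_def is_arg_min_linorder by auto
  have "(\<Sum>k\<in>customers M. p k * q k) \<le> (\<Sum>k\<in>customers M. p k * ?q k)"
    if q': "q \<in> network_set M" for q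
  proof -
    \<comment> \<open>The price at which the bids \<open>b\<close> produce the quantities
      \<open>q\<close>.\<close>
    define p' where "p' = (\<lambda>k. (b k - q k) / sensitivity M)"
    have q_eq: "q k = - sensitivity M * p' k + b k" for k
      using sensitivity by (simp add: p'_def)
    define S where "S = (\<Sum>k\<in>customers M. p k * (p' k - p k))"
    define W where "W = (\<Sum>k\<in>customers M. (p' k - p k)\<^sup>2)"
    \<comment> \<open>Moving from \<open>p\<close> a fraction \<open>t\<close> towards
      \<open>p'\<close> stays feasible by convexity, so the squared norm cannot decrease; its
      increment is divided by \<open>t\<close>.\<close>
    have quad: "0 \<le> 2 * S + t * W" if t: "0 < t" "t \<le> 1" for t
    proof -
      have "mix t ?q q \<in> network_set M"
        using convex_network_set q q' t by (simp add: convex_set_def)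
      moreover have "mix t ?q q = (\<lambda>k. - sensitivity M * mix t p p' k + b k)"
        by (rule ext) (simp add: mix_def q_eq algebra_simps)
      ultimately have "(\<Sum>k\<in>customers M. (p k)\<^sup>2) \<le> (\<Sum>k\<in>customers M. (mix t p p' k)\<^sup>2)"
        by (intro opt) simp
      also have "\<dots> = (\<Sum>k\<in>customers M. (p k)\<^sup>2 + t * (2 * (p k * (p' k - p k)) + t * (p' k - p k)\<^sup>2))"
        by (intro sum.cong) (simp_all add: mix_def power2_eq_square algebra_simps)
      also have "\<dots> = (\<Sum>k\<in>customers M. (p k)\<^sup>2) + t * (2 * S + t * W)"
        by (simp add: S_def W_def sum.distrib sum_distrib_left distrib_left)
      finally have "0 \<le> t * (2 * S + t * W)" by simp
      then show ?thesis using t by (simp add: zero_le_mult_iff)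
    qed
    have "0 \<le> S"
    proof (rule ccontr)
      assume neg: "\<not> 0 \<le> S"
      have W: "0 \<le> W" by (simp add: W_def sum_nonneg)
      \<comment> \<open>Small enough for \<open>t * W \<le> - S\<close>, so that
        \<open>2 * S + t * W \<le> S < 0\<close> contradicts \<open>quad\<close>. The added 1 keeps
        the denominator positive.\<close>
      define t where "t = min 1 (- S / (W + 1))"
      have t: "0 < t" "t \<le> 1" using neg W by (auto simp: t_def field_simps)
      have "t * (W + 1) \<le> (- S / (W + 1)) * (W + 1)"
        using W by (intro mult_right_mono) (simp_all add: t_def)
      then have "t * (W + 1) \<le> - S"
        using W by simp
      then have "t * W \<le> - S" using t by (simp add: algebra_simps)
      with quad[OF t] neg show False by simp
    qed
    moreover have "(\<Sum>k\<in>customers M. p k * ?q k) - (\<Sum>k\<in>customers M. p k * q k) = sensitivity M * S"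
      by (simp add: S_def sum_distrib_left q_eq algebra_simps flip: sum_subtractf)
    ultimately show ?thesis
      using sensitivity by (smt (verit) mult_nonneg_nonneg)
  qed
  with q show "?q \<in> network_set M \<and> ?R" by blast
next
  assume R: "?q \<in> network_set M \<and> ?R"
  have "(\<Sum>k\<in>customers M. (p k)\<^sup>2) \<le> (\<Sum>k\<in>customers M. (p' k)\<^sup>2)"
    if "(\<lambda>k. - sensitivity M * p' k + b k) \<in> network_set M" for p'
  proof -
    have "0 \<le> (\<Sum>k\<in>customers M. p k * ?q k) - (\<Sum>k\<in>customers M. p k * (- sensitivity M * p' k + b k))"
      using R that by force
    also have "\<dots> = sensitivity M * (\<Sum>k\<in>customers M. p k * (p' k - p k))"
      by (simp add: sum_distrib_left algebra_simps flip: sum_subtractf)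
    finally have "0 \<le> (\<Sum>k\<in>customers M. p k * (p' k - p k))"
      using sensitivity by (simp add: zero_le_mult_iff)
    also have "2 * \<dots> \<le> (\<Sum>k\<in>customers M. (p' k)\<^sup>2 - (p k)\<^sup>2)"
      unfolding sum_distrib_left
    proof (rule sum_mono)
      fix k
      show "2 * (p k * (p' k - p k)) \<le> (p' k)\<^sup>2 - (p k)\<^sup>2"
        using zero_le_power2[of "p' k - p k"] by (simp add: power2_eq_square algebra_simps)
    qed
    finally show ?thesis by (simp add: sum_subtractf)
  qed
  with R show ?L
    unfolding operator_optimal_def is_arg_min_linorder by blast
qed

text \<open>The two optimality characterizations combine into the saddle point conditions with the
  prices as multipliers. If the bid relation fails, neither side holds.\<close>

lemma market_equilibrium_iff:
  "market_equilibrium M (d, b, q, p) \<longleftrightarrow>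
    saddle_point d q p \<and> (\<forall>k\<in>customers M. b k = q k + sensitivity M * p k)"
proof (cases "\<forall>k\<in>customers M. b k = q k + sensitivity M * p k")
  case True
  let ?q = "\<lambda>k. - sensitivity M * p k + b k"
  have eq: "?q k = q k" if "k \<in> customers M" for k
    using True that by simp
  \<comment> \<open>\<open>?q\<close> and \<open>q\<close> agree on customers only, hence the detour
    through \<open>network_set_cong\<close>.\<close>
  have "?q \<in> network_set M \<longleftrightarrow> q \<in> network_set M"
    using network_set_cong[of q ?q] network_set_cong[of ?q q] eq by auto
  moreover have "(\<Sum>k\<in>customers M. p k * ?q k) = (\<Sum>k\<in>customers M. p k * q k)"
    using eq by (intro sum.cong) auto
  ultimately show ?thesis
    using True
    unfolding market_equilibrium_def saddle_point_def prod.case operator_optimal_iff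
    by (auto simp: customer_optimal_iff)
next
  case False
  then show ?thesis
    by (auto simp: market_equilibrium_def customer_optimal_iff)
qed

section \<open>Optimality, uniqueness and duality from a saddle point\<close>

text \<open>If \<open>y\<close> did as well as \<open>d k\<close>, strict convexity would make their
  midpoint better than the minimizer \<open>d k\<close>.\<close>

lemma saddle_point_less:
  assumes sp: "saddle_point d q \<eta>" and k: "k \<in> customers M"
    and y: "y \<in> {demand_min M k..demand_max M k}" "y \<noteq> d k"
  shows "disutility M k (d k) + \<eta> k * d k < disutility M k y + \<eta> k * y"
proof -
  define z where "z = (1 - 1/2) * d k + 1/2 * y"
  have "z \<in> {demand_min M k..demand_max M k}"
    using sp k y by (auto simp: saddle_point_def z_def)
  then have "disutility M k (d k) + \<eta> k * d k \<le> disutility M k z + \<eta> k * z"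
    using sp k by (simp add: saddle_point_def)
  moreover have "disutility M k z < (1 - 1/2) * disutility M k (d k) + 1/2 * disutility M k y"
    unfolding z_def by (rule strictly_convex_combination[OF k]) (use y in auto)
  ultimately show ?thesis
    by (simp add: z_def algebra_simps)
qed

text \<open>The Lagrangian splits into a demand part, a constant and the pairing with
  \<open>q\<close>. The saddle point minimizes the first and maximizes the last, and its own
  Lagrangian value is its cost. The strict version yields uniqueness.\<close>

lemma saddle_point_lagrangian_le:
  assumes sp: "saddle_point d q \<eta>"
    and d': "\<forall>k\<in>customers M. d' k \<in> {demand_min M k..demand_max M k}" and q': "q' \<in> network_set M"
  shows "total_disutility M d \<le> lagrangian M \<eta> d' q'"
    and "\<exists>k\<in>customers M. d' k \<noteq> d k \<Longrightarrow> total_disutility M d < lagrangian M \<eta> d' q'"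
proof -
  define L where "L = (\<lambda>e. \<Sum>k\<in>customers M. disutility M k (e k) + \<eta> k * e k)"
  define Q where "Q = (\<lambda>q. \<Sum>k\<in>customers M. \<eta> k * q k)"
  have split: "lagrangian M \<eta> e r = L e + (\<Sum>k\<in>customers M. \<eta> k * offset M k) - Q r" for e r
    unfolding lagrangian_eq total_disutility_def L_def Q_def
    by (simp add: algebra_simps flip: sum.distrib sum_subtractf)
  have "Q q' \<le> Q q"
    using sp q' unfolding saddle_point_def Q_def by blast
  moreover have "total_disutility M d = lagrangian M \<eta> d q"
    using sp by (simp add: lagrangian_eq saddle_point_def)
  ultimately have *: "total_disutility M d \<le> lagrangian M \<eta> d' q' - (L d' - L d)"
    by (simp add: split)
  have le: "disutility M k (d k) + \<eta> k * d k \<le> disutility M k (d' k) + \<eta> k * d' k"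
    if "k \<in> customers M" for k
    using sp d' that by (simp add: saddle_point_def)
  then have "L d \<le> L d'"
    unfolding L_def by (intro sum_mono)
  with * show "total_disutility M d \<le> lagrangian M \<eta> d' q'" by simp
  assume "\<exists>k\<in>customers M. d' k \<noteq> d k"
  then obtain k where "k \<in> customers M" "d' k \<noteq> d k" by blast
  moreover from this have "disutility M k (d k) + \<eta> k * d k < disutility M k (d' k) + \<eta> k * d' k"
    using d' by (intro saddle_point_less[OF sp]) auto
  ultimately have "L d < L d'"
    unfolding L_def using le by (intro sum_strict_mono_ex1 finite_customers) auto
  with * show "total_disutility M d < lagrangian M \<eta> d' q'" by simp
qed

lemma central_feasible_iff:
  "central_feasible M (d, q) \<longleftrightarrow>
    (\<forall>k\<in>customers M. d k \<in> {demand_min M k..demand_max M k} \<and> q k = d k + offset M k) \<and>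
    q \<in> network_set M"
  by (auto simp: central_feasible_def power_balance_iff)

lemma lagrangian_feasible: "central_feasible M (d, q) \<Longrightarrow> lagrangian M \<eta> d q = total_disutility M d"
  by (simp add: central_feasible_iff lagrangian_eq)

lemma saddle_point_feasible: "saddle_point d q \<eta> \<Longrightarrow> central_feasible M (d, q)"
  by (simp add: central_feasible_iff saddle_point_def)

lemma saddle_point_central_optimal:
  assumes sp: "saddle_point d q \<eta>"
  shows "central_optimal M (d, q)"
  unfolding central_optimal_def is_arg_min_linorder
proof (intro conjI allI impI)
  show "central_feasible M (d, q)" by (rule saddle_point_feasible[OF sp])
  fix s assume s: "central_feasible M s"
  obtain d' q' where s_eq: "s = (d', q')" by (cases s)
  show "(case (d, q) of (d, q) \<Rightarrow> total_disutility M d) \<le> (case s of (d, q) \<Rightarrow> total_disutility M d)"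
    using saddle_point_lagrangian_le(1)[OF sp, of d' q'] s lagrangian_feasible[of d' q' \<eta>]
    by (simp add: s_eq central_feasible_iff)
qed

text \<open>At a feasible point the Lagrangian equals the cost, so the strict inequality would make
  a different demand more expensive.\<close>

lemma saddle_point_unique:
  assumes sp: "saddle_point d q \<eta>" and opt: "central_optimal M (d', q')" and k: "k \<in> customers M"
  shows "d' k = d k"
proof (rule ccontr)
  assume "d' k \<noteq> d k"
  have feas: "central_feasible M (d', q')" and le: "total_disutility M d' \<le> total_disutility M d"
    using opt saddle_point_feasible[OF sp] unfolding central_optimal_def is_arg_min_linorder by auto
  have "total_disutility M d < lagrangian M \<eta> d' q'"
    using feas k \<open>d' k \<noteq> d k\<close> by (intro saddle_point_lagrangian_le(2)[OF sp]) (auto simp: central_feasible_iff)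
  with le lagrangian_feasible[OF feas] show False by simp
qed

text \<open>Weak duality at the feasible pair \<open>(d, q)\<close> bounds every dual value by its
  cost; the saddle inequality shows that \<eta> reaches this bound, which also excludes minus
  infinity.\<close>

lemma saddle_point_dual_optimal:
  assumes sp: "saddle_point d q \<eta>"
  shows "dual_optimal M \<eta>"
proof -
  have lower: "ereal (total_disutility M d) \<le> dual_function M \<eta>"
    unfolding dual_function_def
    by (rule INF_greatest) (use saddle_point_lagrangian_le(1)[OF sp] in auto)
  have upper: "dual_function M \<eta>' \<le> ereal (total_disutility M d)" for \<eta>'
  proof -
    note feas = saddle_point_feasible[OF sp]
    have "dual_function M \<eta>' \<le> ereal (lagrangian M \<eta>' d q)"
      unfolding dual_function_def
      by (rule INF_lower2[of "(d, q)"]) (use feas in \<open>auto simp: central_feasible_iff\<close>)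
    then show ?thesis by (simp add: lagrangian_feasible[OF feas])
  qed
  have "dual_function M \<eta> > - \<infinity>"
    using lower by (metis MInfty_neq_ereal(1) ereal_infty_less(2) ereal_infty_less_eq(2))
  then show ?thesis
    unfolding dual_optimal_def is_arg_max_linorder
    using lower upper order_trans by blast
qed

end

theorem proposition2:
  fixes M :: "('b, 'g, 'e, 'k) market"
  assumes "energy_sharing_market M"
  shows "((\<exists>d b q price. market_equilibrium M (d, b, q, price)) \<longleftrightarrow>
            (\<exists>d q. central_feasible M (d, q))) \<and>
         (\<forall>d b q price. market_equilibrium M (d, b, q, price) \<longrightarrow>
            (\<exists>q'. central_optimal M (d, q')) \<and>
            (\<forall>d' q'. central_optimal M (d', q') \<longrightarrow> (\<forall>k\<in>customers M. d' k = d k)) \<and>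
            (\<exists>\<eta>. dual_optimal M \<eta> \<and> (\<forall>k\<in>customers M. price k = \<eta> k)) \<and>
            (\<forall>k\<in>consumers M. q k = d k + fixed_demand M k) \<and>
            (\<forall>k\<in>prosumers M. q k = d k + fixed_demand M k - renewable M k) \<and>
            (\<forall>k\<in>customers M. b k = q k + sensitivity M * price k))"
proof -
  interpret energy_sharing_market M by fact
  have "\<exists>d b q p. market_equilibrium M (d, b, q, p)" if feas: "central_feasible M (d, q)" for d q
  proof -
    obtain d q p where "saddle_point d q p"
      using saddle_point_exists[OF feas] by blast
    then have "market_equilibrium M (d, \<lambda>k. q k + sensitivity M * p k, q, p)"
      by (simp add: market_equilibrium_iff)
    then show ?thesis by blast
  qed
  moreover have "\<exists>d q. central_feasible M (d, q)" if "market_equilibrium M (d, b, q, p)" for d b q p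
    using that saddle_point_feasible unfolding market_equilibrium_iff by blast
  moreover have "(\<exists>q'. central_optimal M (d, q')) \<and>
      (\<forall>d' q'. central_optimal M (d', q') \<longrightarrow> (\<forall>k\<in>customers M. d' k = d k)) \<and>
      (\<exists>\<eta>. dual_optimal M \<eta> \<and> (\<forall>k\<in>customers M. p k = \<eta> k)) \<and>
      (\<forall>k\<in>consumers M. q k = d k + fixed_demand M k) \<and>
      (\<forall>k\<in>prosumers M. q k = d k + fixed_demand M k - renewable M k) \<and>
      (\<forall>k\<in>customers M. b k = q k + sensitivity M * p k)"
    if eq: "market_equilibrium M (d, b, q, p)" for d b q p
  proof -
    have sp: "saddle_point d q p" and b: "\<forall>k\<in>customers M. b k = q k + sensitivity M * p k"
      using eq by (simp_all add: market_equilibrium_iff)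
    have "\<forall>k\<in>consumers M. q k = d k + fixed_demand M k"
      "\<forall>k\<in>prosumers M. q k = d k + fixed_demand M k - renewable M k"
      using sp disjoint by (auto simp: saddle_point_def customers_def offset_def)
    \<comment> \<open>The price vector \<open>p\<close> itself is the dual optimal
      multiplier.\<close>
    with sp b show ?thesis
      using saddle_point_central_optimal saddle_point_unique saddle_point_dual_optimal by blast
  qed
  ultimately show ?thesis by blast
qed

end
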